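(* Let $(X_t)_{t\in\mathbb{N}}$ be the Elo process started from a random $X_0\in\mathcal{Z}_N$. Let $\phi(x)=\|x\|^pe^{\theta\|x\|}$ for some $p\in[0,\infty)$ and $\theta\in[0,\theta_0]$, where $\theta_0>0$ is the drift constant described in the context. If $\mathbb{E}[\phi(X_0)]<\infty$, then $$\sup_{t\in\mathbb{N}}\mathbb{E}[\phi(X_t)]<\infty.$$
   Context: Notation: $\mathbb{N}=\{0,1,2,\dots\}$; $N\ge 2$ is an integer (number of players); $\|\cdot\|$ is the Euclidean norm on $\mathbb{R}^N$; $x^i$ is the $i$-th coordinate of $x$; $e_i$ is the $i$-th canonical vector; $\mathcal{Z}_N=\{x\in\mathbb{R}^N:\sum_{i=1}^N x^i=0\}$. Standing assumptions. (i) $\rho=(\rho^1,\dots,\rho^N)\in\mathcal{Z}_N$ is a fixed vector (true skills). (ii) $b:\mathbb{R}\to(-1,1)$ is odd, strictly increasing and $L$-Lipschitz, and for every $M>0$, $\ell_M:=\inf_{-M\le v<u\le M}\frac{b(u)-b(v)}{u-v}>0$. (iii) For every distinct $i,j\in\{1,\dots,N\}$, $S^{ij}$ is a random variable with values in $[-1,1]$, $\mathbb{E}[S^{ij}]=b(\rho^i-\rho^j)$ and $S^{ji}=-S^{ij}$. (iv) $K>0$ is a constant with $KL<1$. (v) For every distinct $i,j$ and every $\epsilon>0$, $\mathbb{P}(S^{ij}<-1+\epsilon)>0$ and $\mathbb{P}(S^{ij}>1-\epsilon)>0$. Elo process: the Markov chain $(X_t)_{t\in\mathbb{N}}$ on $\mathcal{Z}_N$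 started from a random vector $X_0\in\mathcal{Z}_N$ with the following dynamics: at step $t$, an ordered pair $(I_t,J_t)$ of distinct indices in $\{1,\dots,N\}$ is chosen uniformly at random (independently of the past); given $I_t=i,J_t=j$, an independent copy $S_t^{ij}$ of $S^{ij}$ is sampled; and $X_{t+1}=X_t+K\{S_t^{ij}-b(X_t^i-X_t^j)\}(e_i-e_j)$. $\mathbb{E}_x$ denotes expectation conditional on $X_0=x$. Drift constant: $\theta_0>0$ denotes a constant with the following property (such a constant exists): for any $\theta\in(0,\theta_0]$ there exist $\lambda\in(0,1)$, $R_1>0$ and $c>0$ (depending on $\theta$) such that for all $x\in\mathcal{Z}_N$, $\mathbb{E}_x[V_\theta(X_1)]\le\lambda V_\theta(x)+c\,\mathbf{1}_{\|x\|\le R_1}$, where $V_\theta(x)=e^{\theta\|x\|}$. *)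

theory Defs
  imports "HOL-Probability.Probability"
begin

definition zero_sum :: "(real ^ 'n::finite) set" where
  "zero_sum = {x. (\<Sum>i\<in>UNIV. x $ i) = 0}"

definition distinct_pairs :: "('n::finite \<times> 'n) set" where
  "distinct_pairs = {(i, j). i \<noteq> j}"

definition slope_inf :: "(real \<Rightarrow> real) \<Rightarrow> real \<Rightarrow> real" where
  "slope_inf b m = (INF (u, v)\<in>{(u, v). - m \<le> v \<and> v < u \<and> u \<le> m}. (b u - b v) / (u - v))"

definition elo_update ::
  "(real \<Rightarrow> real) \<Rightarrow> real \<Rightarrow> real ^ 'n::finite \<Rightarrow> 'n \<Rightarrow> 'n \<Rightarrow> real \<Rightarrow> real ^ 'n" where
  "elo_update b K x i j s = x + (K * (s - b (x $ i - x $ j))) *\<^sub>R (axis i 1 - axis j 1)"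

text \<open>
  The scores \<open>S i j\<close> live on an auxiliary probability space \<open>\<Omega>\<close>; only their values for
  \<open>i \<noteq> j\<close> are constrained or used.
\<close>
locale elo_model =
  fixes \<Omega> :: "'w measure"
    and S :: "'n::finite \<Rightarrow> 'n \<Rightarrow> 'w \<Rightarrow> real"
    and \<rho> :: "real ^ 'n"
    and b :: "real \<Rightarrow> real"
    and L K :: real
  assumes players: "CARD('n) \<ge> 2"
    and skills: "\<rho> \<in> zero_sum"
    and b_range: "\<And>u. b u \<in> {-1<..<1}"
    and b_odd: "\<And>u. b (- u) = - b u"
    and b_strict_mono: "strict_mono b"
    and b_lipschitz: "L-lipschitz_on UNIV b"
    and b_slope: "\<And>m. m > 0 \<Longrightarrow> slope_inf b m > 0"
    and prob_space_scores: "prob_space \<Omega>"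
    and score_measurable: "\<And>i j. i \<noteq> j \<Longrightarrow> S i j \<in> borel_measurable \<Omega>"
    and score_range: "\<And>i j w. i \<noteq> j \<Longrightarrow> w \<in> space \<Omega> \<Longrightarrow> S i j w \<in> {-1..1}"
    and score_mean: "\<And>i j. i \<noteq> j \<Longrightarrow> (\<integral>w. S i j w \<partial>\<Omega>) = b (\<rho> $ i - \<rho> $ j)"
    and score_antisym: "\<And>i j w. i \<noteq> j \<Longrightarrow> w \<in> space \<Omega> \<Longrightarrow> S j i w = - S i j w"
    and K_pos: "K > 0"
    and K_small: "K * L < 1"
    and score_near_bot:
      "\<And>i j \<epsilon>. i \<noteq> j \<Longrightarrow> \<epsilon> > 0 \<Longrightarrow> measure \<Omega> {w \<in> space \<Omega>. S i j w < -1 + \<epsilon>} > 0"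
    and score_near_top:
      "\<And>i j \<epsilon>. i \<noteq> j \<Longrightarrow> \<epsilon> > 0 \<Longrightarrow> measure \<Omega> {w \<in> space \<Omega>. S i j w > 1 - \<epsilon>} > 0"

text \<open>
  \<open>elo_history M X I J T t\<close> is the sigma-algebra generated by the initial state and by the
  pairs \<open>(I s, J s)\<close> and sampled scores \<open>T s\<close> of all steps \<open>s < t\<close>.
\<close>
definition elo_history ::
  "'a measure \<Rightarrow> (nat \<Rightarrow> 'a \<Rightarrow> real ^ 'n::finite) \<Rightarrow> (nat \<Rightarrow> 'a \<Rightarrow> 'n) \<Rightarrow> (nat \<Rightarrow> 'a \<Rightarrow> 'n)
    \<Rightarrow> (nat \<Rightarrow> 'a \<Rightarrow> real) \<Rightarrow> nat \<Rightarrow> 'a set set" where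
  "elo_history M X I J T t = sigma_sets (space M)
     ({{w \<in> space M. X 0 w \<in> B} |B. B \<in> sets borel} \<union>
      (\<Union>s<t. {{w \<in> space M. I s w = i \<and> J s w = j \<and> T s w \<in> B} |i j B. B \<in> sets borel}))"

text \<open>
  \<open>T t\<close> is the score realised at step \<open>t\<close>. Assumption \<open>sampling\<close> says that, conditionally on
  the past, the pair \<open>(I t, J t)\<close> is uniform on the ordered pairs of distinct indices and that,
  given \<open>(I t, J t) = (i, j)\<close>, the score \<open>T t\<close> has the law of \<open>S i j\<close>. Taking \<open>A\<close> and \<open>B\<close> to be
  the whole spaces shows that \<open>I t \<noteq> J t\<close> almost surely.
\<close>
locale elo_process = elo_model \<Omega> S \<rho> b L K
  for \<Omega> :: "'w measure" and S :: "'n::finite \<Rightarrow> 'n \<Rightarrow> 'w \<Rightarrow> real" and \<rho> :: "real ^ 'n"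
    and b :: "real \<Rightarrow> real" and L K :: real +
  fixes M :: "'a measure"
    and X :: "nat \<Rightarrow> 'a \<Rightarrow> real ^ 'n"
    and I J :: "nat \<Rightarrow> 'a \<Rightarrow> 'n"
    and T :: "nat \<Rightarrow> 'a \<Rightarrow> real"
  assumes prob_space_process: "prob_space M"
    and initial_measurable: "X 0 \<in> borel_measurable M"
    and initial_zero_sum: "\<And>w. w \<in> space M \<Longrightarrow> X 0 w \<in> zero_sum"
    and first_measurable: "\<And>t. I t \<in> measurable M (count_space UNIV)"
    and second_measurable: "\<And>t. J t \<in> measurable M (count_space UNIV)"
    and sampled_measurable: "\<And>t. T t \<in> borel_measurable M"
    and sampling: "\<And>t A i j B. A \<in> elo_history M X I J T t \<Longrightarrow> i \<noteq> j \<Longrightarrow> B \<in> sets borel \<Longrightarrow>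
        measure M (A \<inter> {w \<in> space M. I t w = i \<and> J t w = j \<and> T t w \<in> B}) =
        measure M A * (1 / real (card (distinct_pairs :: ('n \<times> 'n) set))) *
          measure \<Omega> {w \<in> space \<Omega>. S i j w \<in> B}"
    and dynamics: "\<And>t w. w \<in> space M \<Longrightarrow>
        X (Suc t) w = elo_update b K (X t w) (I t w) (J t w) (T t w)"

text \<open>The expectation of \<open>f (X 1)\<close> for the Elo process started from the fixed state \<open>x\<close>.\<close>
definition elo_expectation ::
  "'w measure \<Rightarrow> ('n::finite \<Rightarrow> 'n \<Rightarrow> 'w \<Rightarrow> real) \<Rightarrow> (real \<Rightarrow> real) \<Rightarrow> real
    \<Rightarrow> real ^ 'n \<Rightarrow> (real ^ 'n \<Rightarrow> real) \<Rightarrow> real" where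
  "elo_expectation \<Omega> S b K x f =
     measure_pmf.expectation (pmf_of_set distinct_pairs)
       (\<lambda>(i, j). \<integral>w. f (elo_update b K x i j (S i j w)) \<partial>\<Omega>)"

definition drift_constant ::
  "'w measure \<Rightarrow> ('n::finite \<Rightarrow> 'n \<Rightarrow> 'w \<Rightarrow> real) \<Rightarrow> (real \<Rightarrow> real) \<Rightarrow> real \<Rightarrow> real \<Rightarrow> bool" where
  "drift_constant \<Omega> S b K \<theta>\<^sub>0 \<longleftrightarrow> \<theta>\<^sub>0 > 0 \<and>
     (\<forall>\<theta>\<in>{0<..\<theta>\<^sub>0}. \<exists>\<gamma>\<in>{0<..<1}. \<exists>R\<^sub>1>0. \<exists>c>0. \<forall>x\<in>zero_sum.
        elo_expectation \<Omega> S b K x (\<lambda>y. exp (\<theta> * norm y))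
          \<le> \<gamma> * exp (\<theta> * norm x) + c * indicator {y. norm y \<le> R\<^sub>1} x)"

text \<open>
  The case distinction implements the convention \<open>0\<close> to the power \<open>0\<close> equals \<open>1\<close>, whereas
  \<open>0 powr 0 = 0\<close>.
\<close>
definition moment_fun :: "real \<Rightarrow> real \<Rightarrow> real ^ 'n::finite \<Rightarrow> real" where
  "moment_fun p \<theta> x = (if p = 0 then 1 else norm x powr p) * exp (\<theta> * norm x)"

end

theory Submission
  imports Defs
begin

text \<open>
  Write \<open>V y = exp (\<theta> * norm y)\<close>. For \<open>\<theta> > 0\<close> the drift condition says that one step multiplies the mean of
  \<open>V\<close> by a factor \<open>\<gamma> < 1\<close>, up to an additive constant. Since scores and win probabilities are
  bounded, one step changes the norm by at most \<open>4 * K\<close>; how the drift is passed on to the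
  function \<open>\<phi> y = norm y powr p * V y\<close> depends on whether \<open>\<theta>\<close> vanishes.

  If \<open>\<theta> > 0\<close>, the polynomial part grows by a factor of at most \<open>(1 + 4 * K / norm x) powr p\<close>, which tends to
  \<open>1\<close> as \<open>norm x\<close> grows. Hence \<open>\<phi>\<close> inherits a geometric drift with a factor \<open>\<mu>\<close> strictly between
  \<open>\<gamma>\<close> and \<open>1\<close> (lemma \<open>moment_fun_drift\<close>), and iterating \<open>m \<mapsto> \<mu> * m + C\<close> never leaves a bounded
  interval (lemma \<open>geometric_drift_moments_bounded\<close>).

  If \<open>\<theta> = 0\<close>, only \<open>p > 0\<close> is of interest, and this argument fails: the process only drifts inwards at bounded speed, so
  \<open>norm y powr p\<close> has no geometric drift. Moreover no exponential moment of the initial state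
  need be finite. Instead, take \<open>V\<close> with the exponent \<open>\<theta>\<^sub>0\<close> and note that \<open>norm y powr p\<close> is
  comparable to \<open>ln (V y + a) powr p\<close>, where \<open>v \<mapsto> ln v powr p\<close> is increasing and concave on
  \<open>v \<ge> exp p\<close>. By Jensen's inequality, the mean of \<open>ln (\<alpha> * V + a) powr p\<close> at some time is at
  most the mean of \<open>ln (\<alpha> * \<gamma> * V + \<alpha> * c + a) powr p\<close> one step earlier. Keeping the affine
  function of \<open>V\<close> inside the logarithm makes the additive constants sum up as a geometric series, so
  going back to time \<open>0\<close> replaces \<open>a\<close> by at most \<open>a + \<alpha> * c / (1 - \<gamma>)\<close>
  (lemma \<open>log_moment_le_initial\<close>).

  Both arguments work with plain expectations, without conditioning on the past. The passage from the
  sampling rule to the one-step kernel is made once, in \<open>nn_integral_step\<close>.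
\<close>

section \<open>One step of the Elo chain from a fixed state\<close>

lemma card_distinct_pairs_pos:
  assumes "CARD('n::finite) \<ge> 2"
  shows "card (distinct_pairs :: ('n \<times> 'n) set) > 0"
proof -
  obtain i j :: 'n where "i \<noteq> j"
    using assms card_le_Suc0_iff_eq[of "UNIV :: 'n set"] by fastforce
  then have "(i, j) \<in> distinct_pairs" by (simp add: distinct_pairs_def)
  then show ?thesis by (auto simp: card_gt_0_iff)
qed

context elo_model
begin

lemma elo_update_measurable [measurable]:
  "(\<lambda>(x, s). elo_update b K x i j s) \<in> borel \<Otimes>\<^sub>M borel \<rightarrow>\<^sub>M (borel :: (real ^ 'n) measure)"
proof -
  have "continuous_on UNIV b"
    using b_lipschitz by (rule lipschitz_on_continuous_on)
  then have "continuous_on UNIV (\<lambda>z. b (fst z $ i - fst z $ j))" for i j :: 'n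
    by (rule continuous_on_compose2) (auto intro!: continuous_intros)
  then have "continuous_on UNIV (\<lambda>(x, s). elo_update b K x i j s :: real ^ 'n)"
    unfolding elo_update_def split_def by (intro continuous_intros)
  then show ?thesis
    unfolding borel_prod by (rule borel_measurable_continuous_onI)
qed

lemma elo_update_compose_measurable [measurable (raw)]:
  assumes "f \<in> G \<rightarrow>\<^sub>M borel" "g \<in> borel_measurable G"
  shows "(\<lambda>w. elo_update b K (f w) i j (g w)) \<in> G \<rightarrow>\<^sub>M (borel :: (real ^ 'n) measure)"
  using measurable_compose[OF measurable_Pair[OF assms] elo_update_measurable[of i j]] by simp

lemma elo_update_zero_sum:
  assumes "x \<in> zero_sum" shows "elo_update b K x i j s \<in> (zero_sum :: (real ^ 'n) set)"
proof -
  have "(\<Sum>k\<in>UNIV. (axis i 1 - axis j 1 :: real ^ 'n) $ k) = 0"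
    by (simp add: sum_subtractf axis_def)
  then have "(\<Sum>k\<in>UNIV. c * ((axis i 1 - axis j 1 :: real ^ 'n) $ k)) = 0" for c
    unfolding sum_distrib_left[symmetric] by simp
  then show ?thesis
    using assms unfolding zero_sum_def elo_update_def
    by (simp add: sum.distrib)
qed

lemma norm_elo_update_le:
  assumes "s \<in> {-1..1}"
  shows "norm (elo_update b K x i j s :: real ^ 'n) \<le> norm x + 4 * K"
proof -
  let ?z = "(K * (s - b (x $ i - x $ j))) *\<^sub>R (axis i 1 - axis j 1) :: real ^ 'n"
  have "\<bar>s - b (x $ i - x $ j)\<bar> \<le> 2"
    using assms b_range[of "x $ i - x $ j"] by auto
  moreover have "norm (axis i 1 - axis j 1 :: real ^ 'n) \<le> 2"
    using norm_triangle_ineq4[of "axis i 1 :: real ^ 'n" "axis j 1"] by simp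
  ultimately have "(K * \<bar>s - b (x $ i - x $ j)\<bar>) * norm (axis i 1 - axis j 1 :: real ^ 'n)
      \<le> (K * 2) * 2"
    using K_pos by (intro mult_mono) auto
  then have "norm ?z \<le> 4 * K"
    using K_pos by (simp add: abs_mult)
  then show ?thesis
    using norm_triangle_ineq[of x ?z] by (simp add: elo_update_def)
qed

lemma integrable_score_bounded:
  fixes f :: "real ^ 'n \<Rightarrow> real"
  assumes "i \<noteq> j" "f \<in> borel_measurable borel"
    and bound: "\<And>s. s \<in> {-1..1} \<Longrightarrow> \<bar>f (elo_update b K x i j s)\<bar> \<le> B"
  shows "integrable \<Omega> (\<lambda>w. f (elo_update b K x i j (S i j w)))"
proof -
  interpret prob_space \<Omega> by (rule prob_space_scores)
  note score_measurable[OF assms(1), measurable] assms(2)[measurable]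
  show ?thesis
    using bound score_range[OF assms(1)]
    by (intro integrable_const_bound[where B = B] AE_I2) auto
qed

lemma elo_expectation_eq_sum:
  "elo_expectation \<Omega> S b K x f =
    (\<Sum>(i, j)\<in>distinct_pairs. \<integral>w. f (elo_update b K x i j (S i j w)) \<partial>\<Omega>)
      / real (card (distinct_pairs :: ('n \<times> 'n) set))"
  using card_distinct_pairs_pos[OF players] unfolding elo_expectation_def
  by (subst integral_pmf_of_set) (auto simp: card_gt_0_iff)

text \<open>
  Every use of the drift condition goes through this comparison. The bound on \<open>f\<close> is needed only
  where the chain can be after one step, so \<open>A\<close> and \<open>B\<close> may depend on \<open>x\<close>; bounded increments
  supply the integrability.
\<close>
lemma elo_expectation_le_affine:
  fixes f g :: "real ^ 'n \<Rightarrow> real"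
  assumes f: "f \<in> borel_measurable borel" and g: "g \<in> borel_measurable borel"
    and f_nonneg: "\<And>y. 0 \<le> f y"
    and g_bound: "\<And>y. norm y \<le> norm x + 4 * K \<Longrightarrow> \<bar>g y\<bar> \<le> D"
    and le: "\<And>y. norm y \<le> norm x + 4 * K \<Longrightarrow> f y \<le> A + B * g y"
  shows "elo_expectation \<Omega> S b K x f \<le> A + B * elo_expectation \<Omega> S b K x g"
proof -
  interpret prob_space \<Omega> by (rule prob_space_scores)
  let ?n = "real (card (distinct_pairs :: ('n \<times> 'n) set))"
  let ?E = "\<lambda>h i j. \<integral>w. h (elo_update b K x i j (S i j w)) \<partial>\<Omega>"
  have n: "?n > 0"
    using card_distinct_pairs_pos[OF players] by simp
  have step: "?E f i j \<le> A + B * ?E g i j" if "i \<noteq> j" for i j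
  proof -
    have reach: "norm (elo_update b K x i j s) \<le> norm x + 4 * K" if "s \<in> {-1..1}" for s
      using norm_elo_update_le[OF that] .
    have int_g: "integrable \<Omega> (\<lambda>w. g (elo_update b K x i j (S i j w)))"
      using g_bound[OF reach] by (intro integrable_score_bounded[OF that g, where B = D]) auto
    have "\<bar>f (elo_update b K x i j s)\<bar> \<le> \<bar>A\<bar> + \<bar>B\<bar> * D" if "s \<in> {-1..1}" for s
    proof -
      have "B * g (elo_update b K x i j s) \<le> \<bar>B\<bar> * D"
        using g_bound[OF reach[OF that]]
        by (metis abs_ge_self abs_ge_zero abs_mult mult_left_mono order_trans)
      then show ?thesis
        using le[OF reach[OF that]] f_nonneg[of "elo_update b K x i j s"] by linarith
    qed
    then have int_f: "integrable \<Omega> (\<lambda>w. f (elo_update b K x i j (S i j w)))"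
      by (rule integrable_score_bounded[OF that f])
    have "?E f i j \<le> (\<integral>w. A + B * g (elo_update b K x i j (S i j w)) \<partial>\<Omega>)"
      using int_f int_g le[OF reach] score_range[OF that]
      by (intro integral_mono) auto
    also have "\<dots> = A + B * ?E g i j"
      using int_g by (simp add: prob_space)
    finally show ?thesis .
  qed
  have "(\<Sum>(i, j)\<in>distinct_pairs. ?E f i j) \<le> (\<Sum>(i, j)\<in>distinct_pairs. A + B * ?E g i j)"
    using step by (intro sum_mono) (auto simp: distinct_pairs_def)
  also have "\<dots> = ?n * A + B * (\<Sum>(i, j)\<in>distinct_pairs. ?E g i j)"
    by (simp add: split_def sum.distrib sum_distrib_left)
  finally show ?thesis
    using n unfolding elo_expectation_eq_sum by (simp add: field_simps)
qed

end

section \<open>The Markov property\<close>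

context elo_process
begin

abbreviation history_measure :: "nat \<Rightarrow> 'a measure" where
  "history_measure t \<equiv> sigma (space M) (elo_history M X I J T t)"

lemma sets_history_measure: "sets (history_measure t) = elo_history M X I J T t"
proof -
  have "elo_history M X I J T t \<subseteq> Pow (space M)"
    unfolding elo_history_def
    by (rule subsetI, rule PowI, erule sigma_sets_into_sp[rotated]) auto
  then have "sets (history_measure t) = sigma_sets (space M) (elo_history M X I J T t)"
    by (rule sets_measure_of)
  also have "\<dots> = elo_history M X I J T t"
    unfolding elo_history_def by (rule sigma_sets_sigma_sets_eq) auto
  finally show ?thesis .
qed

lemma space_history_measure: "space (history_measure t) = space M"
  by (simp add: space_measure_of_conv)

text \<open>
  Stated for an arbitrary sigma-algebra \<open>G\<close> because it serves twice: for \<open>M\<close> itself, and for the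
  history, where it says that the state is determined by the past.
\<close>
lemma state_measurable_if_inputs_measurable:
  assumes space: "space G = space M" and "X 0 \<in> borel_measurable G"
    and inputs: "\<And>s. s < t \<Longrightarrow> I s \<in> G \<rightarrow>\<^sub>M count_space UNIV"
      "\<And>s. s < t \<Longrightarrow> J s \<in> G \<rightarrow>\<^sub>M count_space UNIV"
      "\<And>s. s < t \<Longrightarrow> T s \<in> borel_measurable G"
  shows "X t \<in> borel_measurable G"
  using inputs
proof (induction t)
  case 0
  show ?case by fact
next
  case (Suc t)
  have [measurable]: "X t \<in> borel_measurable G" "T t \<in> borel_measurable G"
    using Suc by auto
  have "(\<lambda>w. elo_update b K (X t w) i (J t w) (T t w)) \<in> borel_measurable G" for i
    by (rule measurable_compose_countable'[where I = UNIV and g = "J t"])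
       (use Suc.prems in auto)
  then have "(\<lambda>w. elo_update b K (X t w) (I t w) (J t w) (T t w)) \<in> borel_measurable G"
    by (rule measurable_compose_countable'[where I = UNIV and g = "I t"])
       (use Suc.prems in auto)
  then show ?case
    using dynamics space by (subst measurable_cong) auto
qed

lemma state_measurable [measurable]: "X t \<in> borel_measurable M"
  by (rule state_measurable_if_inputs_measurable)
     (auto intro: initial_measurable first_measurable second_measurable sampled_measurable)

lemma state_measurable_history: "X t \<in> borel_measurable (history_measure t)"
proof (rule state_measurable_if_inputs_measurable)
  show "space (history_measure t) = space M"
    by (rule space_history_measure)
  show "X 0 \<in> borel_measurable (history_measure t)"
  proof (rule measurableI)
    fix B :: "(real ^ 'n) set" assume "B \<in> sets borel"
    then have "{w \<in> space M. X 0 w \<in> B} \<in> elo_history M X I J T t"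
      unfolding elo_history_def by (intro sigma_sets.Basic) auto
    moreover have "X 0 -` B \<inter> space M = {w \<in> space M. X 0 w \<in> B}"
      by auto
    ultimately show "X 0 -` B \<inter> space (history_measure t) \<in> sets (history_measure t)"
      unfolding sets_history_measure space_history_measure by simp
  qed simp
next
  fix s assume s: "s < t"
  have basic: "{w \<in> space M. I s w = i \<and> J s w = j \<and> T s w \<in> B} \<in> sets (history_measure t)"
    if "B \<in> sets borel" for i j B
  proof -
    have "{w \<in> space M. I s w = i \<and> J s w = j \<and> T s w \<in> B} \<in> elo_history M X I J T t"
      using s that unfolding elo_history_def by (intro sigma_sets.Basic) auto
    then show ?thesis
      by (simp only: sets_history_measure)
  qed
  have "I s -` {i} \<inter> space M = (\<Union>j. {w \<in> space M. I s w = i \<and> J s w = j \<and> T s w \<in> UNIV})"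
    for i by auto
  then have "I s -` {i} \<inter> space M \<in> sets (history_measure t)" for i
    using basic[of UNIV i] by (auto intro!: sets.finite_UN)
  then show "I s \<in> history_measure t \<rightarrow>\<^sub>M count_space UNIV"
    by (subst measurable_count_space_eq2) (auto simp: space_history_measure)
  have "J s -` {j} \<inter> space M = (\<Union>i. {w \<in> space M. I s w = i \<and> J s w = j \<and> T s w \<in> UNIV})"
    for j by auto
  then have "J s -` {j} \<inter> space M \<in> sets (history_measure t)" for j
    using basic[of UNIV _ j] by (auto intro!: sets.finite_UN)
  then show "J s \<in> history_measure t \<rightarrow>\<^sub>M count_space UNIV"
    by (subst measurable_count_space_eq2) (auto simp: space_history_measure)
  show "T s \<in> borel_measurable (history_measure t)"
  proof (rule measurableI)
    fix B :: "real set" assume B: "B \<in> sets borel"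
    have "T s -` B \<inter> space M =
        (\<Union>i. \<Union>j. {w \<in> space M. I s w = i \<and> J s w = j \<and> T s w \<in> B})"
      by auto
    then show "T s -` B \<inter> space (history_measure t) \<in> sets (history_measure t)"
      using basic[OF B] by (auto intro!: sets.finite_UN simp: space_history_measure)
  qed simp
qed

lemma state_zero_sum: "w \<in> space M \<Longrightarrow> X t w \<in> zero_sum"
  by (induction t) (simp_all add: initial_zero_sum dynamics elo_update_zero_sum)

text \<open>
  The sampling rule is the special case of measurable rectangles, with the past event
  \<open>X t \<in> A\<close>; rectangles determine a product measure. The scaling by the number of pairs
  makes the right-hand side a probability measure: it is the joint law of state and score given that
  \<open>(i, j)\<close> is drawn.
\<close>
lemma state_score_law:
  assumes "i \<noteq> j"
  shows "distr M borel (X t) \<Otimes>\<^sub>M distr \<Omega> borel (S i j) =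
    scale_measure (of_nat (card (distinct_pairs :: ('n \<times> 'n) set)))
      (distr (density M (indicator {w \<in> space M. I t w = i \<and> J t w = j}))
        (borel \<Otimes>\<^sub>M borel) (\<lambda>w. (X t w, T t w)))"
proof -
  interpret M: prob_space M by (rule prob_space_process)
  interpret \<Omega>: prob_space \<Omega> by (rule prob_space_scores)
  note [measurable] = first_measurable second_measurable sampled_measurable
    score_measurable[OF assms]
  interpret dX: prob_space "distr M borel (X t)" by (rule M.prob_space_distr) measurable
  interpret dS: prob_space "distr \<Omega> borel (S i j)" by (rule \<Omega>.prob_space_distr) measurable
  let ?n = "card (distinct_pairs :: ('n \<times> 'n) set)"
  let ?C = "{w \<in> space M. I t w = i \<and> J t w = j}"
  let ?D = "distr (density M (indicator ?C)) (borel \<Otimes>\<^sub>M borel) (\<lambda>w. (X t w, T t w))"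
  have n: "?n > 0"
    by (rule card_distinct_pairs_pos[OF players])
  have C [measurable]: "?C \<in> sets M"
    by measurable
  show ?thesis
  proof (rule pair_measure_eqI)
    fix A :: "(real ^ 'n) set" and B :: "real set"
    assume "A \<in> sets (distr M borel (X t))" "B \<in> sets (distr \<Omega> borel (S i j))"
    then have A [measurable]: "A \<in> sets borel" and B [measurable]: "B \<in> sets borel"
      by simp_all
    have past: "X t -` A \<inter> space M \<in> elo_history M X I J T t"
      using measurable_sets[OF state_measurable_history A]
      by (simp only: sets_history_measure space_history_measure)
    have eq: "(X t -` A \<inter> space M) \<inter> {w \<in> space M. I t w = i \<and> J t w = j \<and> T t w \<in> B} =
        ?C \<inter> {w \<in> space M. X t w \<in> A \<and> T t w \<in> B}"
      by auto
    have vS: "{w \<in> space \<Omega>. S i j w \<in> B} = S i j -` B \<inter> space \<Omega>"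
      by auto
    have "emeasure ?D (A \<times> B) = emeasure M (?C \<inter> {w \<in> space M. X t w \<in> A \<and> T t w \<in> B})"
    proof -
      have "(\<lambda>w. (X t w, T t w)) -` (A \<times> B) \<inter> space M = {w \<in> space M. X t w \<in> A \<and> T t w \<in> B}"
        by auto
      then show ?thesis
        by (subst emeasure_distr) (auto simp: emeasure_density nn_integral_set_ennreal
            simp flip: indicator_inter_arith)
    qed
    also have "\<dots> = ennreal (measure M (X t -` A \<inter> space M) * (1 / real ?n) *
        measure \<Omega> (S i j -` B \<inter> space \<Omega>))"
      using sampling[OF past assms B] unfolding eq vS by (simp add: M.emeasure_eq_measure)
    finally have D: "emeasure ?D (A \<times> B) = ennreal (measure M (X t -` A \<inter> space M) *
        (1 / real ?n) * measure \<Omega> (S i j -` B \<inter> space \<Omega>))" .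
    have "emeasure (distr M borel (X t)) A * emeasure (distr \<Omega> borel (S i j)) B =
        ennreal (measure M (X t -` A \<inter> space M) * measure \<Omega> (S i j -` B \<inter> space \<Omega>))"
      by (simp add: emeasure_distr M.emeasure_eq_measure \<Omega>.emeasure_eq_measure ennreal_mult)
    also have "\<dots> = of_nat ?n * emeasure ?D (A \<times> B)"
      unfolding D using n
      by (simp add: ennreal_of_nat_eq_real_of_nat card_gt_0_iff flip: ennreal_mult)
    finally show "emeasure (distr M borel (X t)) A * emeasure (distr \<Omega> borel (S i j)) B =
        emeasure (scale_measure (of_nat ?n) ?D) (A \<times> B)"
      by simp
  qed (unfold_locales, simp)
qed

text \<open>
  The pairs of distinct players carry equal masses that add up to \<open>1\<close>, so nothing is left for the
  diagonal.
\<close>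
lemma ordered_pair_distinct: "AE w in M. (I t w, J t w) \<in> distinct_pairs"
proof -
  interpret M: prob_space M by (rule prob_space_process)
  interpret \<Omega>: prob_space \<Omega> by (rule prob_space_scores)
  note [measurable] = first_measurable second_measurable
  let ?n = "card (distinct_pairs :: ('n \<times> 'n) set)"
  let ?C = "\<lambda>(i, j). {w \<in> space M. I t w = i \<and> J t w = j}"
  have top: "space M \<in> elo_history M X I J T t"
    unfolding elo_history_def by (rule sigma_sets_top)
  have "measure M (?C (i, j)) = 1 / real ?n" if "(i, j) \<in> distinct_pairs" for i j
  proof -
    have "space M \<inter> {w \<in> space M. I t w = i \<and> J t w = j \<and> T t w \<in> UNIV} = ?C (i, j)"
      by auto
    then show ?thesis
      using sampling[OF top, of i j UNIV] that
      by (simp add: distinct_pairs_def M.prob_space \<Omega>.prob_space)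
  qed
  then have "(\<Sum>ij\<in>distinct_pairs. measure M (?C ij)) = 1"
    using card_distinct_pairs_pos[OF players] by (simp add: card_gt_0_iff split_paired_all cong: sum.cong)
  moreover have "measure M (\<Union>ij\<in>distinct_pairs. ?C ij) = (\<Sum>ij\<in>distinct_pairs. measure M (?C ij))"
    by (rule M.finite_measure_finite_Union)
       (auto simp: disjoint_family_on_def split: prod.splits)
  moreover have "(\<Union>ij\<in>distinct_pairs. ?C ij) = {w \<in> space M. (I t w, J t w) \<in> distinct_pairs}"
    by auto
  ultimately have "M.prob {w \<in> space M. (I t w, J t w) \<in> distinct_pairs} = 1"
    by simp
  then show ?thesis
    by (subst (asm) M.prob_Collect_eq_1) auto
qed

text \<open>
  The Markov property in the only form used below: split the event space according to the drawn pair
  and apply the product law on each part.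
\<close>
lemma nn_integral_step:
  fixes f :: "real ^ 'n \<Rightarrow> ennreal"
  assumes f [measurable]: "f \<in> borel_measurable borel"
  shows "(\<integral>\<^sup>+w. f (X (Suc t) w) \<partial>M) =
    (\<integral>\<^sup>+w. (\<Sum>(i, j)\<in>distinct_pairs. \<integral>\<^sup>+v. f (elo_update b K (X t w) i j (S i j v)) \<partial>\<Omega>)
       / of_nat (card (distinct_pairs :: ('n \<times> 'n) set)) \<partial>M)"
proof -
  interpret M: prob_space M by (rule prob_space_process)
  interpret \<Omega>: prob_space \<Omega> by (rule prob_space_scores)
  note [measurable] = first_measurable second_measurable sampled_measurable
  let ?n = "card (distinct_pairs :: ('n \<times> 'n) set)"
  let ?C = "\<lambda>i j. {w \<in> space M. I t w = i \<and> J t w = j}"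
  let ?P = "\<lambda>i j x. \<integral>\<^sup>+v. f (elo_update b K x i j (S i j v)) \<partial>\<Omega>"
  have n: "?n > 0"
    by (rule card_distinct_pairs_pos[OF players])
  have meas_P: "?P i j \<in> borel_measurable borel" if "i \<noteq> j" for i j
  proof -
    note score_measurable[OF that, measurable]
    show ?thesis by measurable
  qed
  have pair: "(\<integral>\<^sup>+w. indicator (?C i j) w * f (elo_update b K (X t w) i j (T t w)) \<partial>M) =
      (\<integral>\<^sup>+w. ?P i j (X t w) \<partial>M) / of_nat ?n" if "i \<noteq> j" for i j
  proof -
    note score_measurable[OF that, measurable]
    interpret dS: prob_space "distr \<Omega> borel (S i j)" by (rule \<Omega>.prob_space_distr) measurable
    let ?h = "\<lambda>(x, s). f (elo_update b K x i j s)"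
    have h [measurable]: "?h \<in> borel_measurable (borel \<Otimes>\<^sub>M borel)"
      by measurable
    have "(\<integral>\<^sup>+w. ?P i j (X t w) \<partial>M) = (\<integral>\<^sup>+x. ?P i j x \<partial>distr M borel (X t))"
      using meas_P[OF that] by (simp add: nn_integral_distr)
    also have "\<dots> = (\<integral>\<^sup>+x. \<integral>\<^sup>+s. ?h (x, s) \<partial>distr \<Omega> borel (S i j) \<partial>distr M borel (X t))"
      by (simp add: nn_integral_distr)
    also have "\<dots> = integral\<^sup>N (distr M borel (X t) \<Otimes>\<^sub>M distr \<Omega> borel (S i j)) ?h"
      by (rule dS.nn_integral_fst) simp
    also have "\<dots> = of_nat ?n *
        (\<integral>\<^sup>+w. indicator (?C i j) w * f (elo_update b K (X t w) i j (T t w)) \<partial>M)"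
      unfolding state_score_law[OF that]
      by (simp add: nn_integral_scale_measure nn_integral_distr nn_integral_density)
    finally show ?thesis
      using n by (simp add: mult.commute[of "of_nat ?n"] ennreal_mult_divide_eq card_gt_0_iff)
  qed
  have "(\<integral>\<^sup>+w. f (X (Suc t) w) \<partial>M) = (\<integral>\<^sup>+w. (\<Sum>(i, j)\<in>distinct_pairs.
      indicator (?C i j) w * f (elo_update b K (X t w) i j (T t w))) \<partial>M)"
  proof (rule nn_integral_cong_AE)
    show "AE w in M. f (X (Suc t) w) = (\<Sum>(i, j)\<in>distinct_pairs.
      indicator (?C i j) w * f (elo_update b K (X t w) i j (T t w)))"
      using ordered_pair_distinct[of t] AE_space
    proof eventually_elim
      fix w assume w: "(I t w, J t w) \<in> distinct_pairs" "w \<in> space M"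
      have "(\<Sum>(i, j)\<in>distinct_pairs. indicator (?C i j) w * f (elo_update b K (X t w) i j (T t w)))
        = (\<Sum>ij\<in>distinct_pairs. if ij = (I t w, J t w) then f (X (Suc t) w) else 0)"
        using w by (intro sum.cong) (auto simp: dynamics indicator_def)
      then show "f (X (Suc t) w) = (\<Sum>(i, j)\<in>distinct_pairs.
        indicator (?C i j) w * f (elo_update b K (X t w) i j (T t w)))"
        using w by simp
    qed
  qed
  also have "\<dots> = (\<Sum>(i, j)\<in>distinct_pairs.
      \<integral>\<^sup>+w. indicator (?C i j) w * f (elo_update b K (X t w) i j (T t w)) \<partial>M)"
    unfolding split_def by (subst nn_integral_sum) auto
  also have "\<dots> = (\<Sum>(i, j)\<in>distinct_pairs. (\<integral>\<^sup>+w. ?P i j (X t w) \<partial>M) / of_nat ?n)"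
    using pair by (intro sum.cong) (auto simp: distinct_pairs_def)
  also have "\<dots> = (\<integral>\<^sup>+w. (\<Sum>(i, j)\<in>distinct_pairs. ?P i j (X t w) / of_nat ?n) \<partial>M)"
    using meas_P unfolding split_def
    by (subst nn_integral_sum)
       (auto simp: distinct_pairs_def divide_ennreal_def nn_integral_multc intro!: sum.cong)
  finally show ?thesis
    by (simp add: split_def divide_ennreal_def sum_distrib_right)
qed

text \<open>
  Local boundedness of \<open>f\<close> is what identifies the extended nonnegative kernel above with the real
  valued \<open>elo_expectation\<close>, in which the drift condition is phrased.
\<close>
lemma nn_integral_step_le:
  fixes f h :: "real ^ 'n \<Rightarrow> real"
  assumes f: "f \<in> borel_measurable borel"
    and f_nonneg: "\<And>y. 0 \<le> f y"
    and f_bound: "\<And>x :: real ^ 'n. \<exists>D. \<forall>y. norm y \<le> norm x + 4 * K \<longrightarrow> f y \<le> D"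
    and le: "\<And>x. x \<in> zero_sum \<Longrightarrow> elo_expectation \<Omega> S b K x f \<le> h x"
  shows "(\<integral>\<^sup>+w. ennreal (f (X (Suc t) w)) \<partial>M) \<le> (\<integral>\<^sup>+w. ennreal (h (X t w)) \<partial>M)"
proof -
  let ?n = "card (distinct_pairs :: ('n \<times> 'n) set)"
  have n: "?n > 0"
    by (rule card_distinct_pairs_pos[OF players])
  have "(\<Sum>(i, j)\<in>distinct_pairs. \<integral>\<^sup>+v. ennreal (f (elo_update b K x i j (S i j v))) \<partial>\<Omega>) / of_nat ?n
      = ennreal (elo_expectation \<Omega> S b K x f)" for x
  proof -
    obtain D where D: "\<And>y. norm y \<le> norm x + 4 * K \<Longrightarrow> f y \<le> D"
      using f_bound[of x] by blast
    have "(\<integral>\<^sup>+v. ennreal (f (elo_update b K x i j (S i j v))) \<partial>\<Omega>) =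
        ennreal (\<integral>v. f (elo_update b K x i j (S i j v)) \<partial>\<Omega>)" if "i \<noteq> j" for i j
      using D[OF norm_elo_update_le] f_nonneg
      by (intro nn_integral_eq_integral integrable_score_bounded[OF that f, where B = D]) auto
    then have "(\<Sum>(i, j)\<in>distinct_pairs. \<integral>\<^sup>+v. ennreal (f (elo_update b K x i j (S i j v))) \<partial>\<Omega>) =
        (\<Sum>(i, j)\<in>distinct_pairs. ennreal (\<integral>v. f (elo_update b K x i j (S i j v)) \<partial>\<Omega>))"
      by (intro sum.cong) (auto simp: distinct_pairs_def)
    also have "\<dots> = ennreal (\<Sum>(i, j)\<in>distinct_pairs. \<integral>v. f (elo_update b K x i j (S i j v)) \<partial>\<Omega>)"
      using f_nonneg unfolding split_def by (intro sum_ennreal integral_nonneg_AE) auto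
    finally show ?thesis
      using n f_nonneg unfolding elo_expectation_eq_sum
      by (simp add: ennreal_of_nat_eq_real_of_nat split_def divide_ennreal sum_nonneg)
  qed
  then have "(\<integral>\<^sup>+w. ennreal (f (X (Suc t) w)) \<partial>M) =
      (\<integral>\<^sup>+w. ennreal (elo_expectation \<Omega> S b K (X t w) f) \<partial>M)"
    using f by (subst nn_integral_step) auto
  also have "\<dots> \<le> (\<integral>\<^sup>+w. ennreal (h (X t w)) \<partial>M)"
    using le state_zero_sum by (intro nn_integral_mono ennreal_leI) auto
  finally show ?thesis .
qed

end

section \<open>Two facts about real functions\<close>

text \<open>
  The second derivative of \<open>v \<mapsto> ln v powr p\<close> has the sign of \<open>p - 1 - ln v\<close>, so the function is
  concave on \<open>v \<ge> exp p\<close>. The bound \<open>exp (p + 1)\<close> in the hypotheses keeps \<open>m\<close> in the interior of that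
  half-line.
\<close>
lemma ln_powr_below_tangent:
  fixes p v m :: real
  assumes p: "p > 0" and v: "v \<ge> exp (p + 1)" and m: "m \<ge> exp (p + 1)"
  shows "ln v powr p \<le> ln m powr p + p * ln m powr (p - 1) / m * (v - m)"
proof -
  let ?A = "{exp p..}"
  have pos: "v > 0" "ln v > 0" "ln v \<ge> p" if "v \<in> ?A" for v
  proof -
    show "v > 0"
      using that by (meson atLeast_iff exp_gt_zero less_le_trans)
    then show "ln v \<ge> p"
      using that by (simp add: ln_ge_iff)
    then show "ln v > 0"
      using p by linarith
  qed
  have D1: "((\<lambda>v. - (ln v powr p)) has_real_derivative - (p * ln v powr (p - 1) / v)) (at v)"
    if "v \<in> ?A" for v
    using pos[OF that] by (auto intro!: derivative_eq_intros)
  have "convex_on ?A (\<lambda>v. - (ln v powr p))"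
  proof (rule f''_ge0_imp_convex[OF _ D1])
    fix v assume v: "v \<in> ?A"
    have split: "ln v powr (p - 1) = ln v powr (p - 2) * ln v"
      using pos[OF v] powr_add[of "ln v" "p - 2" 1] by simp
    show "((\<lambda>v. - (p * ln v powr (p - 1) / v)) has_real_derivative
        p * ln v powr (p - 2) * (ln v - (p - 1)) / v\<^sup>2) (at v)"
      using pos[OF v]
      by (auto intro!: derivative_eq_intros simp: split field_simps power2_eq_square)
    show "p * ln v powr (p - 2) * (ln v - (p - 1)) / v\<^sup>2 \<ge> 0"
      using pos[OF v] p by simp
  qed auto
  moreover have m_in: "m \<in> interior ?A"
  proof -
    have "exp p < exp (p + 1)" by simp
    also note m
    finally show ?thesis by simp
  qed
  moreover have "v \<in> ?A" and m_mem: "m \<in> ?A"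
    using v m order_trans[of "exp p" "exp (p + 1)"] by auto
  ultimately have "- (p * ln m powr (p - 1) / m) * (v - m) \<le> - (ln v powr p) - - (ln m powr p)"
    using has_field_derivative_at_within[OF D1[OF m_mem]]
    by (intro convex_on_imp_above_tangent[where A = ?A]) auto
  then show ?thesis by simp
qed

text \<open>
  Since \<open>((r + d) / r) powr p\<close> tends to \<open>1\<close>, half of the gap between \<open>\<gamma>\<close> and \<open>1\<close> pays for the shift
  once \<open>r\<close> is large.
\<close>
lemma shifted_powr_absorbed:
  fixes p d \<gamma> :: real
  assumes "0 < \<gamma>" "\<gamma> < 1"
  shows "\<exists>R>0. \<forall>r\<ge>R. \<gamma> * (r + d) powr p \<le> (1 + \<gamma>) / 2 * r powr p"
proof -
  have "((\<lambda>r. (1 + d / r) powr p) \<longlongrightarrow> (1 + 0) powr p) at_top"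
    by (intro tendsto_intros tendsto_divide_0[OF tendsto_const] filterlim_at_top_imp_at_infinity
        filterlim_ident) auto
  moreover have "(1 + 0) powr p < (1 + \<gamma>) / (2 * \<gamma>)"
    using assms by (simp add: field_simps)
  ultimately have "\<forall>\<^sub>F r in at_top. (1 + d / r) powr p < (1 + \<gamma>) / (2 * \<gamma>)"
    by (rule order_tendstoD(2))
  then have "\<forall>\<^sub>F r in at_top. \<gamma> * (r + d) powr p \<le> (1 + \<gamma>) / 2 * r powr p"
    using eventually_gt_at_top[of "max 0 (- d)"]
  proof eventually_elim
    fix r :: real assume less: "(1 + d / r) powr p < (1 + \<gamma>) / (2 * \<gamma>)" and r: "max 0 (- d) < r"
    have "(r + d) powr p = (r * (1 + d / r)) powr p"
      using r by (simp add: distrib_left)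
    also have "\<dots> = r powr p * (1 + d / r) powr p"
      by (rule powr_mult)
    also have "\<dots> \<le> r powr p * ((1 + \<gamma>) / (2 * \<gamma>))"
      using less by (intro mult_left_mono) auto
    finally show "\<gamma> * (r + d) powr p \<le> (1 + \<gamma>) / 2 * r powr p"
      using assms by (simp add: field_simps)
  qed
  then obtain R where "\<And>r. r \<ge> R \<Longrightarrow> \<gamma> * (r + d) powr p \<le> (1 + \<gamma>) / 2 * r powr p"
    unfolding eventually_at_top_linorder by blast
  then show ?thesis
    by (intro exI[of _ "max R 1"]) auto
qed

section \<open>Drift of polynomial-exponential and of logarithmic moments\<close>

lemma moment_fun_nonneg: "0 \<le> moment_fun p \<theta> x"
  by (simp add: moment_fun_def)

lemma moment_fun_measurable [measurable]: "moment_fun p \<theta> \<in> borel_measurable borel"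
  unfolding moment_fun_def by measurable

lemma moment_fun_le:
  assumes "p \<ge> 0" "norm y \<le> r" "r > 0"
  shows "moment_fun p \<theta> y \<le> r powr p * exp (\<theta> * norm y)"
  using assms by (auto simp: moment_fun_def intro!: powr_mono2)

context elo_model
begin

text \<open>
  The polynomial factor after the step is at most \<open>(norm x + 4 * K) powr p\<close>, a constant for fixed \<open>x\<close>,
  so the drift of the exponential applies to what remains. Far out, the shift by \<open>4 * K\<close> is absorbed in
  the contraction factor; on a ball everything is bounded.
\<close>
lemma moment_fun_drift:
  assumes drift: "drift_constant \<Omega> S b K \<theta>\<^sub>0" and \<theta>: "\<theta> \<in> {0<..\<theta>\<^sub>0}" and p: "p \<ge> 0"
  obtains \<mu> C where "0 \<le> \<mu>" "\<mu> < 1" "0 \<le> C"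
    "\<And>x. x \<in> zero_sum \<Longrightarrow> elo_expectation \<Omega> S b K x (moment_fun p \<theta>) \<le> \<mu> * moment_fun p \<theta> x + C"
proof -
  let ?V = "\<lambda>y :: real ^ 'n. exp (\<theta> * norm y)"
  obtain \<gamma> R\<^sub>1 c where \<gamma>: "0 < \<gamma>" "\<gamma> < 1" and R\<^sub>1: "R\<^sub>1 > 0" and c: "c > 0"
    and V_drift: "\<And>x. x \<in> zero_sum \<Longrightarrow> elo_expectation \<Omega> S b K x ?V
      \<le> \<gamma> * ?V x + c * indicator {y. norm y \<le> R\<^sub>1} x"
    using drift \<theta> unfolding drift_constant_def by (meson greaterThanLessThan_iff)
  obtain R where R: "R > 0"
    and absorb: "\<And>r. r \<ge> R \<Longrightarrow> \<gamma> * (r + 4 * K) powr p \<le> (1 + \<gamma>) / 2 * r powr p"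
    using shifted_powr_absorbed[OF \<gamma>] by blast
  let ?R = "max R R\<^sub>1"
  let ?C = "(?R + 4 * K) powr p * (exp (\<theta> * ?R) + c)"
  show ?thesis
  proof (rule that[of "(1 + \<gamma>) / 2" ?C])
    fix x :: "real ^ 'n" assume x: "x \<in> zero_sum"
    let ?r = "norm x"
    let ?q = "(?r + 4 * K) powr p"
    have q: "?r + 4 * K > 0"
      using K_pos by (simp add: add_nonneg_pos)
    have "elo_expectation \<Omega> S b K x (moment_fun p \<theta>) \<le> 0 + ?q * elo_expectation \<Omega> S b K x ?V"
      using moment_fun_le[OF p _ q] \<theta>
      by (intro elo_expectation_le_affine[where D = "exp (\<theta> * (?r + 4 * K))"])
         (auto simp: moment_fun_nonneg mult_left_mono)
    also have "\<dots> \<le> ?q * (\<gamma> * ?V x + c * indicator {y. norm y \<le> R\<^sub>1} x)"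
      using V_drift[OF x] by (simp add: mult_left_mono)
    also have "\<dots> \<le> (1 + \<gamma>) / 2 * moment_fun p \<theta> x + ?C"
    proof (cases "?r > ?R")
      case True
      then have "?q * (\<gamma> * ?V x + c * indicator {y. norm y \<le> R\<^sub>1} x) = (\<gamma> * ?q) * ?V x"
        by simp
      also have "\<dots> \<le> ((1 + \<gamma>) / 2 * ?r powr p) * ?V x"
        using True by (intro mult_right_mono absorb) auto
      also have "\<dots> = (1 + \<gamma>) / 2 * moment_fun p \<theta> x"
        using True R by (auto simp: moment_fun_def)
      also have "\<dots> \<le> (1 + \<gamma>) / 2 * moment_fun p \<theta> x + ?C"
        using c by simp
      finally show ?thesis .
    next
      case False
      have "\<gamma> * ?V x \<le> 1 * exp (\<theta> * ?R)"
        using \<gamma> False \<theta> by (intro mult_mono) auto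
      moreover have "c * indicator {y. norm y \<le> R\<^sub>1} x \<le> c"
        using c by (simp add: indicator_def)
      ultimately have "\<gamma> * ?V x + c * indicator {y. norm y \<le> R\<^sub>1} x \<le> exp (\<theta> * ?R) + c"
        by linarith
      then have "?q * (\<gamma> * ?V x + c * indicator {y. norm y \<le> R\<^sub>1} x) \<le> ?C"
        using False q p \<gamma> c by (intro mult_mono powr_mono2) auto
      then show ?thesis
        using \<gamma> moment_fun_nonneg[of p \<theta> x] by (simp add: add_increasing)
    qed
    finally show "elo_expectation \<Omega> S b K x (moment_fun p \<theta>) \<le> (1 + \<gamma>) / 2 * moment_fun p \<theta> x + ?C" .
  qed (use \<gamma> c in auto)
qed

text \<open>
  Jensen's inequality for the concave function \<open>v \<mapsto> ln v powr p\<close>, proved by integrating the tangent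
  at \<open>m\<close>. The point \<open>m\<close> is the drift bound for the mean of \<open>\<alpha> * V + a\<close> rather than this mean itself,
  which is harmless because the tangent is increasing.
\<close>
lemma log_moment_drift:
  fixes \<alpha> \<gamma> c a p \<theta> :: real
  assumes V_drift: "elo_expectation \<Omega> S b K x (\<lambda>y. exp (\<theta> * norm y)) \<le> \<gamma> * exp (\<theta> * norm x) + c"
    and "\<theta> > 0" "p > 0" "\<alpha> \<ge> 0" "\<gamma> \<ge> 0" "c \<ge> 0" and a: "a \<ge> exp (p + 1)"
  shows "elo_expectation \<Omega> S b K x (\<lambda>y. ln (\<alpha> * exp (\<theta> * norm y) + a) powr p)
    \<le> ln (\<alpha> * \<gamma> * exp (\<theta> * norm x) + (\<alpha> * c + a)) powr p"
proof -
  let ?V = "\<lambda>y :: real ^ 'n. exp (\<theta> * norm y)"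
  define m where "m = \<alpha> * \<gamma> * ?V x + (\<alpha> * c + a)"
  have m: "m \<ge> exp (p + 1)"
    using assms by (simp add: m_def add_increasing)
  have m_pos: "m > 0"
    using m by (meson exp_gt_zero less_le_trans)
  define s where "s = p * ln m powr (p - 1) / m"
  have s: "s \<ge> 0"
    using m_pos assms by (simp add: s_def)
  have "elo_expectation \<Omega> S b K x (\<lambda>y. ln (\<alpha> * ?V y + a) powr p)
      \<le> (ln m powr p + s * (a - m)) + s * \<alpha> * elo_expectation \<Omega> S b K x ?V"
  proof (rule elo_expectation_le_affine)
    fix y :: "real ^ 'n"
    have "\<alpha> * ?V y + a \<ge> exp (p + 1)"
      using a assms by (simp add: add_increasing)
    from ln_powr_below_tangent[OF \<open>p > 0\<close> this m]
    have "ln (\<alpha> * ?V y + a) powr p \<le> ln m powr p + s * (\<alpha> * ?V y + a - m)"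
      by (simp add: s_def)
    also have "s * (\<alpha> * ?V y + a - m) = s * (a - m) + s * \<alpha> * ?V y"
      by (simp add: algebra_simps)
    finally show "ln (\<alpha> * ?V y + a) powr p \<le> (ln m powr p + s * (a - m)) + s * \<alpha> * ?V y"
      by simp
  next
    fix y :: "real ^ 'n" assume "norm y \<le> norm x + 4 * K"
    then show "\<bar>?V y\<bar> \<le> exp (\<theta> * (norm x + 4 * K))"
      using assms by simp
  qed auto
  also have "\<dots> = ln m powr p + s * (\<alpha> * elo_expectation \<Omega> S b K x ?V + a - m)"
    by (simp add: algebra_simps)
  also have "\<dots> \<le> ln m powr p"
  proof -
    have "\<alpha> * elo_expectation \<Omega> S b K x ?V + a \<le> m"
      using mult_left_mono[OF V_drift \<open>\<alpha> \<ge> 0\<close>] by (simp add: m_def algebra_simps)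
    then show ?thesis
      using s by (simp add: mult_nonneg_nonpos)
  qed
  finally show ?thesis
    by (simp add: m_def)
qed

end

section \<open>Moment bounds uniform in time\<close>

context elo_process
begin

lemma geometric_drift_moments_bounded:
  fixes f :: "real ^ 'n \<Rightarrow> real"
  assumes f [measurable]: "f \<in> borel_measurable borel"
    and f_nonneg: "\<And>y. 0 \<le> f y"
    and f_bound: "\<And>x :: real ^ 'n. \<exists>D. \<forall>y. norm y \<le> norm x + 4 * K \<longrightarrow> f y \<le> D"
    and drift: "\<And>x. x \<in> zero_sum \<Longrightarrow> elo_expectation \<Omega> S b K x f \<le> \<mu> * f x + C"
    and \<mu>: "0 \<le> \<mu>" "\<mu> < 1" and C: "0 \<le> C"
  shows "(\<integral>\<^sup>+w. ennreal (f (X t w)) \<partial>M) \<le> (\<integral>\<^sup>+w. ennreal (f (X 0 w)) \<partial>M) + ennreal (C / (1 - \<mu>))"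
proof (induction t)
  case 0
  show ?case by simp
next
  case (Suc t)
  interpret M: prob_space M by (rule prob_space_process)
  let ?E = "\<lambda>t. \<integral>\<^sup>+w. ennreal (f (X t w)) \<partial>M"
  have fixpoint: "\<mu> * (C / (1 - \<mu>)) + C = C / (1 - \<mu>)"
    using \<mu> by (simp add: field_simps)
  have "?E (Suc t) \<le> (\<integral>\<^sup>+w. ennreal (\<mu> * f (X t w) + C) \<partial>M)"
    using f f_nonneg f_bound drift by (rule nn_integral_step_le)
  also have "\<dots> = ennreal \<mu> * ?E t + ennreal C"
    using \<mu> C f_nonneg
    by (simp add: ennreal_plus ennreal_mult nn_integral_add nn_integral_cmult M.emeasure_space_1)
  also have "\<dots> \<le> ennreal \<mu> * (?E 0 + ennreal (C / (1 - \<mu>))) + ennreal C"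
    using Suc by (intro add_right_mono mult_left_mono) auto
  also have "\<dots> = ennreal \<mu> * ?E 0 + ennreal (C / (1 - \<mu>))"
    using \<mu> C fixpoint by (simp add: distrib_left add.assoc flip: ennreal_mult ennreal_plus)
  also have "\<dots> \<le> 1 * ?E 0 + ennreal (C / (1 - \<mu>))"
    using \<mu> by (intro add_right_mono mult_right_mono) auto
  finally show ?case by simp
qed

text \<open>
  The induction runs backwards in time with \<open>\<alpha>\<close> and \<open>a\<close> generalized: one step replaces
  \<open>(\<alpha>, a)\<close> by \<open>(\<alpha> * \<gamma>, \<alpha> * c + a)\<close>, and \<open>\<alpha> * c / (1 - \<gamma>) + a\<close> is invariant under this map.
  The decrease of \<open>\<alpha>\<close> is given away at the end.
\<close>
lemma log_moment_le_initial:
  fixes \<theta> \<gamma> c a p :: real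
  assumes V_drift: "\<And>x. x \<in> zero_sum \<Longrightarrow>
      elo_expectation \<Omega> S b K x (\<lambda>y. exp (\<theta> * norm y)) \<le> \<gamma> * exp (\<theta> * norm x) + c"
    and pos: "\<theta> > 0" "p > 0" "0 \<le> \<gamma>" "\<gamma> < 1" "c \<ge> 0"
    and "\<alpha> \<ge> 0" "a \<ge> exp (p + 1)"
  shows "(\<integral>\<^sup>+w. ennreal (ln (\<alpha> * exp (\<theta> * norm (X t w)) + a) powr p) \<partial>M)
    \<le> (\<integral>\<^sup>+w. ennreal (ln (\<alpha> * exp (\<theta> * norm (X 0 w)) + (\<alpha> * c / (1 - \<gamma>) + a)) powr p) \<partial>M)"
  using assms(7-)
proof (induction t arbitrary: \<alpha> a)
  case (0 \<alpha> a)
  have one: "exp (p + 1) \<ge> (1 :: real)"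
    using pos by simp
  have ge1: "\<alpha> * exp (\<theta> * norm (X 0 w)) + a \<ge> 1" for w
    using order_trans[OF one 0(2)] 0(1) by (simp add: add_increasing)
  have "\<alpha> * c / (1 - \<gamma>) \<ge> 0"
    using 0 pos by simp
  then have "ln (\<alpha> * exp (\<theta> * norm (X 0 w)) + a)
      \<le> ln (\<alpha> * exp (\<theta> * norm (X 0 w)) + (\<alpha> * c / (1 - \<gamma>) + a))" for w
    using ge1[of w] by (intro ln_mono) linarith+
  then show ?case
    using pos ge1 by (intro nn_integral_mono ennreal_leI powr_mono2) auto
next
  case (Suc t \<alpha> a)
  let ?V = "\<lambda>y :: real ^ 'n. exp (\<theta> * norm y)"
  let ?F = "\<lambda>\<alpha> a y. ln (\<alpha> * ?V y + a) powr p"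
  have one: "exp (p + 1) \<ge> (1 :: real)"
    using pos by simp
  have ge1: "\<alpha> * ?V y + a \<ge> 1" for y
    using order_trans[OF one Suc.prems(2)] Suc.prems(1) by (simp add: add_increasing)
  have a': "\<alpha> * c + a \<ge> exp (p + 1)"
    using Suc.prems pos by (simp add: add_increasing)
  have "(\<integral>\<^sup>+w. ennreal (?F \<alpha> a (X (Suc t) w)) \<partial>M)
      \<le> (\<integral>\<^sup>+w. ennreal (?F (\<alpha> * \<gamma>) (\<alpha> * c + a) (X t w)) \<partial>M)"
  proof (rule nn_integral_step_le)
    fix x :: "real ^ 'n" assume "x \<in> zero_sum"
    from log_moment_drift[OF V_drift[OF this] pos(1,2) Suc.prems(1) pos(3,5) Suc.prems(2)]
    show "elo_expectation \<Omega> S b K x (?F \<alpha> a) \<le> ?F (\<alpha> * \<gamma>) (\<alpha> * c + a) x" .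
  next
    fix x :: "real ^ 'n"
    show "\<exists>D. \<forall>y. norm y \<le> norm x + 4 * K \<longrightarrow> ?F \<alpha> a y \<le> D"
    proof (intro exI[of _ "ln (\<alpha> * exp (\<theta> * (norm x + 4 * K)) + a) powr p"] allI impI)
      fix y :: "real ^ 'n" assume "norm y \<le> norm x + 4 * K"
      then have "\<alpha> * ?V y + a \<le> \<alpha> * exp (\<theta> * (norm x + 4 * K)) + a"
        using pos Suc.prems by (simp add: mult_left_mono)
      then show "?F \<alpha> a y \<le> ln (\<alpha> * exp (\<theta> * (norm x + 4 * K)) + a) powr p"
        using ge1[of y] pos by (intro powr_mono2) auto
    qed
  qed auto
  also have "\<dots> \<le> (\<integral>\<^sup>+w. ennreal (?F (\<alpha> * \<gamma>) (\<alpha> * \<gamma> * c / (1 - \<gamma>) + (\<alpha> * c + a)) (X 0 w)) \<partial>M)"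
    using a' Suc.prems pos by (intro Suc.IH) auto
  also have "\<dots> \<le> (\<integral>\<^sup>+w. ennreal (?F \<alpha> (\<alpha> * c / (1 - \<gamma>) + a) (X 0 w)) \<partial>M)"
  proof (intro nn_integral_mono ennreal_leI powr_mono2 ln_mono ln_ge_zero)
    fix w
    have eq: "\<alpha> * \<gamma> * c / (1 - \<gamma>) + (\<alpha> * c + a) = \<alpha> * c / (1 - \<gamma>) + a"
      using pos by (simp add: field_simps)
    have "\<alpha> * \<gamma> * ?V (X 0 w) \<le> \<alpha> * ?V (X 0 w)"
      using pos Suc.prems by (intro mult_right_mono mult_left_le) auto
    then show "\<alpha> * \<gamma> * ?V (X 0 w) + (\<alpha> * \<gamma> * c / (1 - \<gamma>) + (\<alpha> * c + a))
        \<le> \<alpha> * ?V (X 0 w) + (\<alpha> * c / (1 - \<gamma>) + a)"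
      unfolding eq by simp
    have "\<alpha> * c / (1 - \<gamma>) \<ge> 0" "\<alpha> * \<gamma> * ?V (X 0 w) \<ge> 0"
      using pos Suc.prems by simp_all
    then show ge: "1 \<le> \<alpha> * \<gamma> * ?V (X 0 w) + (\<alpha> * \<gamma> * c / (1 - \<gamma>) + (\<alpha> * c + a))"
      unfolding eq using one Suc.prems by linarith
    then show "0 < \<alpha> * \<gamma> * ?V (X 0 w) + (\<alpha> * \<gamma> * c / (1 - \<gamma>) + (\<alpha> * c + a))"
      by linarith
  qed (use pos in auto)
  finally show ?case .
qed

text \<open>
  For every \<open>u \<ge> 0\<close>, the numbers \<open>norm y\<close> and \<open>ln (exp (\<theta> * norm y) + u) / \<theta>\<close> differ by at most
  \<open>ln (1 + u) / \<theta>\<close>, which transfers the logarithmic estimate to the moment of order \<open>p\<close>. The factor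
  \<open>2 powr p\<close> comes from splitting off this difference.
\<close>
lemma polynomial_moment_bounded:
  assumes drift: "drift_constant \<Omega> S b K \<theta>" and p: "p > 0"
  obtains B where "0 \<le> B"
    "\<And>t. (\<integral>\<^sup>+w. ennreal (norm (X t w) powr p) \<partial>M)
      \<le> ennreal (2 powr p) * (\<integral>\<^sup>+w. ennreal (norm (X 0 w) powr p) \<partial>M) + ennreal B"
proof -
  interpret M: prob_space M by (rule prob_space_process)
  let ?V = "\<lambda>y :: real ^ 'n. exp (\<theta> * norm y)"
  have \<theta>: "\<theta> > 0"
    using drift by (simp add: drift_constant_def)
  then obtain \<gamma> R\<^sub>1 c where \<gamma>: "0 < \<gamma>" "\<gamma> < 1" and c: "c > 0"
    and V_drift: "\<And>x. x \<in> zero_sum \<Longrightarrow> elo_expectation \<Omega> S b K x ?V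
      \<le> \<gamma> * ?V x + c * indicator {y. norm y \<le> R\<^sub>1} x"
    using drift unfolding drift_constant_def
    by (metis greaterThanAtMost_iff greaterThanLessThan_iff order_refl)
  have V_drift': "elo_expectation \<Omega> S b K x ?V \<le> \<gamma> * ?V x + c" if "x \<in> zero_sum" for x
  proof -
    have "c * indicator {y. norm y \<le> R\<^sub>1} x \<le> c"
      using c by (simp add: indicator_def)
    then show ?thesis
      using V_drift[OF that] by linarith
  qed
  define a where "a = c / (1 - \<gamma>) + exp (p + 1)"
  have a: "a > 0"
    using c \<gamma> by (simp add: a_def add_nonneg_pos)
  define B where "B = (2 * (ln (1 + a) / \<theta>)) powr p"
  have "(\<integral>\<^sup>+w. ennreal (norm (X t w) powr p) \<partial>M)
      \<le> ennreal (2 powr p) * (\<integral>\<^sup>+w. ennreal (norm (X 0 w) powr p) \<partial>M) + ennreal B" for t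
  proof -
    have lower: "(norm y) powr p \<le> \<theta> powr (- p) * ln (1 * ?V y + exp (p + 1)) powr p"
      for y :: "real ^ 'n"
    proof -
      have "\<theta> * norm y = ln (?V y)"
        by simp
      also have "\<dots> \<le> ln (1 * ?V y + exp (p + 1))"
        by (intro ln_mono) (auto simp: add_pos_pos)
      finally have "(\<theta> * norm y) powr p \<le> ln (1 * ?V y + exp (p + 1)) powr p"
        using p \<theta> by (intro powr_mono2) auto
      then have "\<theta> powr (- p) * (\<theta> * norm y) powr p
          \<le> \<theta> powr (- p) * ln (1 * ?V y + exp (p + 1)) powr p"
        by (intro mult_left_mono) auto
      then show ?thesis
        using \<theta> by (simp add: powr_mult powr_minus field_simps)
    qed
    have upper: "\<theta> powr (- p) * ln (1 * ?V y + (1 * c / (1 - \<gamma>) + exp (p + 1))) powr p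
        \<le> 2 powr p * norm y powr p + B" for y :: "real ^ 'n"
    proof -
      \<comment> \<open>As \<open>V \<ge> 1\<close>, adding \<open>a\<close> to \<open>V\<close> costs at most a factor, hence a constant in the logarithm.\<close>
      have "?V y + a \<le> ?V y * (1 + a)"
        using a \<theta> by (simp add: distrib_left mult_le_cancel_right1)
      then have "ln (?V y + a) \<le> ln (?V y * (1 + a))"
        using a by (intro ln_mono) (auto simp: add_pos_pos)
      also have "\<dots> = \<theta> * (norm y + ln (1 + a) / \<theta>)"
        using a \<theta> by (subst ln_mult) (auto simp: distrib_left)
      finally have "ln (?V y + a) \<le> \<theta> * (norm y + ln (1 + a) / \<theta>)" .
      moreover have "ln (?V y + a) \<ge> 0"
        using a \<theta> by (simp add: add_increasing2)
      ultimately have "ln (?V y + a) powr p \<le> (\<theta> * (norm y + ln (1 + a) / \<theta>)) powr p"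
        using p by (intro powr_mono2) auto
      also have "\<dots> = \<theta> powr p * (norm y + ln (1 + a) / \<theta>) powr p"
        by (rule powr_mult)
      finally have "\<theta> powr (- p) * ln (?V y + a) powr p \<le> (norm y + ln (1 + a) / \<theta>) powr p"
        using \<theta> by (simp add: powr_minus field_simps)
      also have "\<dots> \<le> (2 * max (norm y) (ln (1 + a) / \<theta>)) powr p"
        using a \<theta> p by (intro powr_mono2) auto
      also have "\<dots> \<le> (2 * norm y) powr p + B"
        by (cases "norm y \<le> ln (1 + a) / \<theta>") (auto simp: max_def B_def)
      also have "(2 * norm y) powr p = 2 powr p * norm y powr p"
        by (simp add: powr_mult)
      finally show ?thesis
        by (simp add: a_def)
    qed
    have "(\<integral>\<^sup>+w. ennreal (norm (X t w) powr p) \<partial>M)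
        \<le> (\<integral>\<^sup>+w. ennreal (\<theta> powr (- p)) * ennreal (ln (1 * ?V (X t w) + exp (p + 1)) powr p) \<partial>M)"
      using lower by (intro nn_integral_mono) (auto simp flip: ennreal_mult intro!: ennreal_leI)
    also have "\<dots> = ennreal (\<theta> powr (- p)) *
        (\<integral>\<^sup>+w. ennreal (ln (1 * ?V (X t w) + exp (p + 1)) powr p) \<partial>M)"
      by (intro nn_integral_cmult) measurable
    also have "\<dots> \<le> ennreal (\<theta> powr (- p)) *
        (\<integral>\<^sup>+w. ennreal (ln (1 * ?V (X 0 w) + (1 * c / (1 - \<gamma>) + exp (p + 1))) powr p) \<partial>M)"
      using \<gamma> c \<theta> p V_drift' by (intro mult_left_mono log_moment_le_initial) auto
    also have "\<dots> = (\<integral>\<^sup>+w. ennreal (\<theta> powr (- p)) *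
        ennreal (ln (1 * ?V (X 0 w) + (1 * c / (1 - \<gamma>) + exp (p + 1))) powr p) \<partial>M)"
      by (intro nn_integral_cmult[symmetric]) measurable
    also have "\<dots> \<le> (\<integral>\<^sup>+w. ennreal (2 powr p * norm (X 0 w) powr p + B) \<partial>M)"
      using upper by (intro nn_integral_mono) (auto simp flip: ennreal_mult intro!: ennreal_leI)
    also have "\<dots> = ennreal (2 powr p) * (\<integral>\<^sup>+w. ennreal (norm (X 0 w) powr p) \<partial>M) + ennreal B"
      by (simp add: B_def ennreal_plus ennreal_mult nn_integral_add nn_integral_cmult
          M.emeasure_space_1)
    finally show ?thesis .
  qed
  moreover have "0 \<le> B"
    by (simp add: B_def)
  ultimately show ?thesis
    using that by blast
qed

end

theorem theorem10:
  fixes \<Omega> :: "'w measure" and S :: "'n::finite \<Rightarrow> 'n \<Rightarrow> 'w \<Rightarrow> real" and \<rho> :: "real ^ 'n"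
    and b :: "real \<Rightarrow> real" and L K :: real
    and M :: "'a measure" and X :: "nat \<Rightarrow> 'a \<Rightarrow> real ^ 'n" and I J :: "nat \<Rightarrow> 'a \<Rightarrow> 'n"
    and T :: "nat \<Rightarrow> 'a \<Rightarrow> real" and \<theta>\<^sub>0 \<theta> p :: real
  assumes "elo_process \<Omega> S \<rho> b L K M X I J T"
    and "drift_constant \<Omega> S b K \<theta>\<^sub>0"
    and "p \<ge> 0" and "\<theta> \<in> {0..\<theta>\<^sub>0}"
    and "(\<integral>\<^sup>+w. ennreal (moment_fun p \<theta> (X 0 w)) \<partial>M) < \<infinity>"
  shows "(SUP t. \<integral>\<^sup>+w. ennreal (moment_fun p \<theta> (X t w)) \<partial>M) < \<infinity>"
proof -
  interpret elo_process \<Omega> S \<rho> b L K M X I J T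
    by (rule assms(1))
  interpret M: prob_space M
    by (rule prob_space_process)
  note drift = assms(2) and p = assms(3) and \<theta> = assms(4) and init = assms(5)
  have "\<exists>B<\<infinity>. \<forall>t. (\<integral>\<^sup>+w. ennreal (moment_fun p \<theta> (X t w)) \<partial>M) \<le> B"
  proof (cases "\<theta> = 0")
    case False
    then have \<theta>': "\<theta> \<in> {0<..\<theta>\<^sub>0}"
      using \<theta> by auto
    obtain \<mu> C where \<mu>: "0 \<le> \<mu>" "\<mu> < 1" and C: "0 \<le> C" and "\<And>x. x \<in> zero_sum \<Longrightarrow>
        elo_expectation \<Omega> S b K x (moment_fun p \<theta>) \<le> \<mu> * moment_fun p \<theta> x + C"
      using moment_fun_drift[OF drift \<theta>' p] by blast
    moreover have "\<exists>D. \<forall>y :: real ^ 'n. norm y \<le> norm x + 4 * K \<longrightarrow> moment_fun p \<theta> y \<le> D"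
      for x :: "real ^ 'n"
    proof (intro exI[of _ "(norm x + 4 * K) powr p * exp (\<theta> * (norm x + 4 * K))"] allI impI)
      fix y :: "real ^ 'n" assume y: "norm y \<le> norm x + 4 * K"
      have "moment_fun p \<theta> y \<le> (norm x + 4 * K) powr p * exp (\<theta> * norm y)"
        using K_pos by (intro moment_fun_le[OF p y]) (simp add: add_nonneg_pos)
      also have "\<dots> \<le> (norm x + 4 * K) powr p * exp (\<theta> * (norm x + 4 * K))"
        using y \<theta> by (intro mult_left_mono) (auto intro: mult_left_mono)
      finally show "moment_fun p \<theta> y \<le> (norm x + 4 * K) powr p * exp (\<theta> * (norm x + 4 * K))" .
    qed
    ultimately have "(\<integral>\<^sup>+w. ennreal (moment_fun p \<theta> (X t w)) \<partial>M)
        \<le> (\<integral>\<^sup>+w. ennreal (moment_fun p \<theta> (X 0 w)) \<partial>M) + ennreal (C / (1 - \<mu>))" for t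
      by (intro geometric_drift_moments_bounded) (auto simp: moment_fun_nonneg)
    then show ?thesis
      using init
      by (intro exI[of _ "(\<integral>\<^sup>+w. ennreal (moment_fun p \<theta> (X 0 w)) \<partial>M) + ennreal (C / (1 - \<mu>))"]) auto
  next
    case \<theta>0: True
    show ?thesis
    proof (cases "p = 0")
      case True
      then show ?thesis
        using \<theta>0 by (intro exI[of _ 1]) (simp add: moment_fun_def M.emeasure_space_1)
    next
      case False
      then obtain B where B: "\<And>t. (\<integral>\<^sup>+w. ennreal (norm (X t w) powr p) \<partial>M)
          \<le> ennreal (2 powr p) * (\<integral>\<^sup>+w. ennreal (norm (X 0 w) powr p) \<partial>M) + ennreal B"
        using polynomial_moment_bounded[OF drift, of p] p by auto
      have "ennreal (2 powr p) * (\<integral>\<^sup>+w. ennreal (norm (X 0 w) powr p) \<partial>M) + ennreal B < \<infinity>"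
        using init False \<theta>0 by (simp add: moment_fun_def ennreal_mult_less_top)
      then have "\<exists>B<\<infinity>. \<forall>t. (\<integral>\<^sup>+w. ennreal (norm (X t w) powr p) \<partial>M) \<le> B"
        using B by blast
      then show ?thesis
        using False \<theta>0 by (simp add: moment_fun_def)
    qed
  qed
  then obtain B where "B < \<infinity>" "\<And>t. (\<integral>\<^sup>+w. ennreal (moment_fun p \<theta> (X t w)) \<partial>M) \<le> B"
    by blast
  then show ?thesis
    by (meson SUP_least le_less_trans)
qed

end
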